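(* Let $\gamma$ be a probability measure on $\mathcal{Y}$, and let the marginal performance measure $H^g:\mathcal{Y}\to\mathbf{R}$ be a bounded (measurable) observable with $H^g\le\bar b$ for a constant $\bar b\in\mathbf{R}$. Write $\widehat{H^g}=\mathbf{E}_\gamma[H^g]$ and $s_g^2=\mathrm{Var}_\gamma[H^g]$, and suppose $\bar b>\widehat{H^g}$. Then for every $c>0$, $$\Lambda_\gamma(c,H^g)\;\le\;\frac1c\log\left(\frac{(\bar b-\widehat{H^g})^2}{(\bar b-\widehat{H^g})^2+s_g^2}\,e^{-c s_g^2/(\bar b-\widehat{H^g})}+\frac{s_g^2}{(\bar b-\widehat{H^g})^2+s_g^2}\,e^{c(\bar b-\widehat{H^g})}\right).$$
   Context: Let $\mathcal{Y},\mathcal{Z}$ be Polish spaces, let $\nu(dz\mid y)$ be a probability kernel from $\mathcal{Y}$ to $\mathcal{Z}$, and let $h:\mathcal{Y}\times\mathcal{Z}\to\mathbf{R}$ be a measurable function representing the quantity of interest. The marginal performance measure is $H^g(y)=\int_{\mathcal{Z}}h(y,z)\,\nu(dz\mid y)$ for $y\in\mathcal{Y}$, viewed as a random variable on $(\mathcal{Y},\gamma)$. The risk-sensitive performance measure is, for $c>0$, $$\Lambda_\gamma(c,H^g)=\frac1c\log\mathbf{E}_\gamma\big[e^{c(H^g-\mathbf{E}_\gamma[H^g])}\big].$$ *)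

theory Defs
  imports "HOL-Probability.Probability"
begin

definition marginal_performance ::
    "('y \<Rightarrow> 'z measure) \<Rightarrow> ('y \<times> 'z \<Rightarrow> real) \<Rightarrow> 'y \<Rightarrow> real" where
  "marginal_performance \<nu> h y = (\<integral>z. h (y, z) \<partial>(\<nu> y))"

definition risk_sensitive_performance ::
    "'y measure \<Rightarrow> real \<Rightarrow> ('y \<Rightarrow> real) \<Rightarrow> real" where
  "risk_sensitive_performance \<gamma> c H =
    1 / c * ln (prob_space.expectation \<gamma>
      (\<lambda>y. exp (c * (H y - prob_space.expectation \<gamma> H))))"

end

theory Submission
  imports Defs
begin

text \<open>
  This is Bennett's inequality for a random variable bounded above: among all laws with mean \<open>0\<close>,
  variance \<open>s\<^sup>2\<close> and support in \<open>(-\<infinity>, a]\<close>, the exponential moment is largest for the law on the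
  two points \<open>-s\<^sup>2/a\<close> and \<open>a\<close> that has this mean and variance, and the bound is its value there.

  Extremality follows by majorisation. Let \<open>q\<close> be the quadratic polynomial that agrees with
  \<open>x \<mapsto> exp (c x)\<close> at \<open>a\<close> and is tangent to it at \<open>-s\<^sup>2/a\<close>. If \<open>q\<close> dominates the
  exponential on \<open>(-\<infinity>, a]\<close>, then so it does in expectation; the expectation of \<open>q\<close> depends only on
  the first two moments, so it is the same for the two-point law, for which \<open>q\<close> and the
  exponential agree on the support.

  The domination \<open>exp (c x) \<le> q x\<close> says that the second-order remainder ratio
  \<open>(exp u - 1 - u) / u\<^sup>2\<close> is monotone in \<open>u\<close>, which is \<open>exp_remainder_ratio_mono\<close>. The moment bound
  is \<open>bennett_exp_moment_bound\<close>; taking logarithms turns it into the theorem.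
\<close>

lemma exp_upper_Taylor_quadratic_nonpos:
  fixes u :: real
  assumes "u \<le> 0"
  shows "exp u \<le> 1 + u + u\<^sup>2 / 2"
proof -
  define v where "v = - u"
  have v: "0 \<le> v" using assms by (simp add: v_def)
  have pos: "0 < 1 - v + v\<^sup>2 / 2"
  proof -
    have "1 - v + v\<^sup>2 / 2 = ((1 - v)\<^sup>2 + 1) / 2"
      by (simp add: power2_eq_square field_simps)
    moreover have "0 < (1 - v)\<^sup>2 + 1" by (intro add_nonneg_pos) auto
    ultimately show ?thesis by (simp only: half_gt_zero)
  qed
  have "1 \<le> 1 + (v\<^sup>2)\<^sup>2 / 4" by simp
  also have "\<dots> = (1 - v + v\<^sup>2 / 2) * (1 + v + v\<^sup>2 / 2)"
    by (simp add: power2_eq_square field_simps)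
  also have "\<dots> \<le> (1 - v + v\<^sup>2 / 2) * exp v"
    using exp_lower_Taylor_quadratic[OF v] pos by (intro mult_left_mono) auto
  finally have "1 \<le> (1 - v + v\<^sup>2 / 2) * exp v" .
  then have "exp (- v) \<le> 1 - v + v\<^sup>2 / 2"
    by (simp add: exp_minus field_simps)
  then show ?thesis by (simp add: v_def)
qed

text \<open>
  The denominators of the ratio are cleared so that \<open>u = 0\<close> needs no exception. For \<open>u \<le> 0\<close> both
  ratios are separated by the value \<open>1/2\<close>, their common limit at \<open>0\<close>; for \<open>u \<ge> 0\<close> the exponential
  series is compared term by term, as \<open>u\<^sup>n \<le> U\<^sup>n\<close>.
\<close>

lemma exp_remainder_ratio_mono:
  fixes u U :: real
  assumes "u \<le> U" "0 \<le> U"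
  shows "(exp u - 1 - u) * U\<^sup>2 \<le> (exp U - 1 - U) * u\<^sup>2"
proof (cases "u \<le> 0")
  case True
  have "(exp u - 1 - u) * U\<^sup>2 \<le> (u\<^sup>2 / 2) * U\<^sup>2"
    using exp_upper_Taylor_quadratic_nonpos[OF True] by (intro mult_right_mono) auto
  also have "\<dots> = (U\<^sup>2 / 2) * u\<^sup>2" by simp
  also have "\<dots> \<le> (exp U - 1 - U) * u\<^sup>2"
    using exp_lower_Taylor_quadratic[OF assms(2)] by (intro mult_right_mono) auto
  finally show ?thesis .
next
  case False
  have sm: "summable (\<lambda>n. inverse (fact (n + 2)) * x ^ (n + 2))" for x :: real
    using summable_exp[of x] by (subst summable_iff_shift)
  have rem: "exp x - 1 - x = (\<Sum>n. inverse (fact (n + 2)) * x ^ (n + 2))" for x :: real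
    using exp_first_two_terms[of x] by simp
  have "(exp u - 1 - u) * U\<^sup>2 = (\<Sum>n. inverse (fact (n + 2)) * u ^ (n + 2) * U\<^sup>2)"
    unfolding rem by (rule suminf_mult2[OF sm])
  also have "\<dots> \<le> (\<Sum>n. inverse (fact (n + 2)) * U ^ (n + 2) * u\<^sup>2)"
  proof (rule suminf_le)
    fix n :: nat
    have "inverse (fact (n + 2)) * (u\<^sup>2 * U\<^sup>2) * u ^ n \<le> inverse (fact (n + 2)) * (u\<^sup>2 * U\<^sup>2) * U ^ n"
      using False assms by (intro mult_left_mono power_mono) auto
    then show "inverse (fact (n + 2)) * u ^ (n + 2) * U\<^sup>2 \<le> inverse (fact (n + 2)) * U ^ (n + 2) * u\<^sup>2"
      by (simp only: power_add mult_ac)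
  qed (intro summable_mult2 sm)+
  also have "\<dots> = (exp U - 1 - U) * u\<^sup>2"
    unfolding rem by (rule suminf_mult2[OF sm, symmetric])
  finally show ?thesis .
qed

text \<open>
  The quadratic on the right is tangent to the exponential at \<open>t\<close> and meets it at \<open>a\<close>: up to the
  factor \<open>exp (c t)\<close> and the shift by \<open>t\<close>, this is the monotone remainder ratio.
\<close>

lemma exp_le_tangent_quadratic:
  fixes a c t x :: real
  assumes "0 \<le> c" "t < a" "x \<le> a"
  shows "exp (c * x) \<le> exp (c * t) * (1 + c * (x - t))
      + (exp (c * a) - exp (c * t) * (1 + c * (a - t))) / (a - t)\<^sup>2 * (x - t)\<^sup>2"
proof (cases "c = 0")
  case False
  with assms have c: "0 < c" by simp
  define u U where "u = c * (x - t)" and "U = c * (a - t)"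
  have "u \<le> U" "0 < U"
    using c assms by (auto simp: u_def U_def)
  then have "exp u - 1 - u \<le> (exp U - 1 - U) * (u\<^sup>2 / U\<^sup>2)"
    using exp_remainder_ratio_mono[of u U] by (simp add: field_simps)
  moreover have "u\<^sup>2 / U\<^sup>2 = (x - t)\<^sup>2 / (a - t)\<^sup>2"
    using c by (simp add: u_def U_def power_mult_distrib)
  ultimately have "exp u \<le> 1 + u + (exp U - 1 - U) * ((x - t)\<^sup>2 / (a - t)\<^sup>2)" by simp
  then have "exp (c * t) * exp u
      \<le> exp (c * t) * (1 + u + (exp U - 1 - U) * ((x - t)\<^sup>2 / (a - t)\<^sup>2))"
    by (rule mult_left_mono) simp
  also have "\<dots> = exp (c * t) * (1 + u)
      + (exp (c * t) * exp U - exp (c * t) * (1 + U)) / (a - t)\<^sup>2 * (x - t)\<^sup>2"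
    by (simp add: algebra_simps diff_divide_distrib add_divide_distrib)
  finally show ?thesis
    by (simp add: u_def U_def exp_add[symmetric] algebra_simps)
qed simp

lemma (in prob_space) integrable_exp_of_le:
  fixes X :: "'a \<Rightarrow> real"
  assumes "integrable M X" "0 \<le> c" "AE \<omega> in M. X \<omega> \<le> a"
  shows "integrable M (\<lambda>\<omega>. exp (c * X \<omega>))"
proof (rule integrable_const_bound[where B = "exp (c * a)"])
  show "AE \<omega> in M. norm (exp (c * X \<omega>)) \<le> exp (c * a)"
    using assms(3) by eventually_elim (use assms(2) in \<open>simp add: mult_left_mono\<close>)
  show "(\<lambda>\<omega>. exp (c * X \<omega>)) \<in> borel_measurable M"
    using assms(1) by measurable
qed

lemma (in prob_space) bennett_exp_moment_bound:
  fixes X :: "'a \<Rightarrow> real"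
  assumes X: "integrable M X" and X2: "integrable M (\<lambda>\<omega>. (X \<omega>)\<^sup>2)"
    and mean: "expectation X = 0"
    and le: "AE \<omega> in M. X \<omega> \<le> a" and a: "0 < a" and c: "0 \<le> c"
    and v: "v = expectation (\<lambda>\<omega>. (X \<omega>)\<^sup>2)"
  shows "expectation (\<lambda>\<omega>. exp (c * X \<omega>))
      \<le> a\<^sup>2 / (a\<^sup>2 + v) * exp (- c * v / a) + v / (a\<^sup>2 + v) * exp (c * a)"
proof -
  have v0: "0 \<le> v" by (simp add: v)
  \<comment> \<open>The lower atom of the extremal law: mean \<open>0\<close> and variance \<open>v\<close> force \<open>t a = - v\<close> for atoms
      \<open>t\<close> and \<open>a\<close>.\<close>
  define t where "t = - v / a"
  have t: "t < a"
  proof -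
    have "t \<le> 0" using v0 a by (simp add: t_def)
    with a show ?thesis by linarith
  qed
  define K where "K = (exp (c * a) - exp (c * t) * (1 + c * (a - t))) / (a - t)\<^sup>2"
  define q where "q x = exp (c * t) * (1 + c * (x - t)) + K * (x - t)\<^sup>2" for x
  \<comment> \<open>The coefficients in powers of \<open>x\<close> reduce the expectation of \<open>q\<close> to the first two moments.\<close>
  have q_expand: "q x = (exp (c * t) * (1 - c * t) + K * t\<^sup>2)
      + (exp (c * t) * c - 2 * K * t) * x + K * x\<^sup>2" for x
    by (simp add: q_def power2_eq_square algebra_simps)
  have int_q: "integrable M (\<lambda>\<omega>. q (X \<omega>))"
    unfolding q_expand using X X2 by (intro Bochner_Integration.integrable_add) auto
  have "expectation (\<lambda>\<omega>. exp (c * X \<omega>)) \<le> expectation (\<lambda>\<omega>. q (X \<omega>))"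
  proof (rule integral_mono_AE[OF integrable_exp_of_le[OF X c le] int_q])
    show "AE \<omega> in M. exp (c * X \<omega>) \<le> q (X \<omega>)"
      using le by eventually_elim (use exp_le_tangent_quadratic[OF c t] in \<open>simp add: q_def K_def\<close>)
  qed
  also have "\<dots> = exp (c * t) * (1 - c * t) + K * (v + t\<^sup>2)"
    unfolding q_expand using X X2 by (simp add: mean v prob_space algebra_simps)
  also have "\<dots> = a\<^sup>2 / (a\<^sup>2 + v) * exp (c * t) + v / (a\<^sup>2 + v) * exp (c * a)"
  proof -
    \<comment> \<open>\<open>p\<close> is the mass of the extremal law at \<open>a\<close>.\<close>
    define p where "p = v / (a\<^sup>2 + v)"
    have den: "0 < a\<^sup>2 + v" using a v0 by (simp add: add_pos_nonneg)
    have at: "a - t = (a\<^sup>2 + v) / a"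
      using a by (simp add: t_def power2_eq_square field_simps)
    have "v + t\<^sup>2 = v * (a\<^sup>2 + v) / a\<^sup>2"
      using a by (simp add: t_def power2_eq_square field_simps)
    also have "\<dots> = p * (a - t)\<^sup>2"
      using a den unfolding at p_def by (simp add: power2_eq_square)
    finally have vt: "v + t\<^sup>2 = p * (a - t)\<^sup>2" .
    have pt: "p * (a - t) = - t"
      using a den unfolding at p_def by (simp add: t_def)
    have "K * (v + t\<^sup>2) = p * (exp (c * a) - exp (c * t) * (1 + c * (a - t)))"
      using t by (simp add: vt K_def)
    also have "\<dots> = p * exp (c * a) - exp (c * t) * (p + c * (p * (a - t)))"
      by (simp add: algebra_simps)
    finally have "exp (c * t) * (1 - c * t) + K * (v + t\<^sup>2) = (1 - p) * exp (c * t) + p * exp (c * a)"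
      unfolding pt by (simp add: algebra_simps)
    moreover have "1 - p = a\<^sup>2 / (a\<^sup>2 + v)"
      using den by (simp add: p_def field_simps)
    ultimately show ?thesis by (simp add: p_def)
  qed
  finally show ?thesis by (simp add: t_def)
qed

theorem theorem3:
  fixes \<gamma> :: "'y::polish_space measure"
    and \<nu> :: "'y \<Rightarrow> 'z::polish_space measure"
    and h :: "'y \<times> 'z \<Rightarrow> real"
    and H :: "'y \<Rightarrow> real"
    and b m s2 c :: real
  assumes kernel: "\<nu> \<in> borel \<rightarrow>\<^sub>M prob_algebra borel"
    and h_meas: "h \<in> borel_measurable (borel \<Otimes>\<^sub>M borel)"
    and h_int: "\<And>y. integrable (\<nu> y) (\<lambda>z. h (y, z))"
    and H_eq: "H = marginal_performance \<nu> h"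
    and prob: "prob_space \<gamma>"
    and sets_eq: "sets \<gamma> = sets borel"
    and H_meas: "H \<in> borel_measurable borel"
    and H_bounded: "bounded (range H)"
    and H_le: "\<And>y. H y \<le> b"
    and m_eq: "m = prob_space.expectation \<gamma> H"
    and s2_eq: "s2 = prob_space.variance \<gamma> H"
    and b_gt: "b > m"
    and c_pos: "c > 0"
  shows "risk_sensitive_performance \<gamma> c H \<le>
    1 / c * ln ((b - m)\<^sup>2 / ((b - m)\<^sup>2 + s2) * exp (- c * s2 / (b - m))
                + s2 / ((b - m)\<^sup>2 + s2) * exp (c * (b - m)))"
proof -
  interpret prob_space \<gamma> by (rule prob)
  define X where "X y = H y - m" for y
  have H_meas': "H \<in> borel_measurable \<gamma>"
    using H_meas sets_eq by (simp cong: measurable_cong_sets)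
  obtain B where B: "\<And>y. \<bar>H y\<bar> \<le> B"
    using H_bounded by (auto simp: bounded_iff)
  have int_H: "integrable \<gamma> H"
    using B H_meas' by (intro integrable_const_bound[where B = B]) auto
  have X: "integrable \<gamma> X"
    unfolding X_def using int_H by auto
  have X_bdd: "\<bar>X y\<bar> \<le> B + \<bar>m\<bar>" for y
    using B[of y] by (simp add: X_def)
  have X2: "integrable \<gamma> (\<lambda>y. (X y)\<^sup>2)"
  proof (rule integrable_const_bound[where B = "(B + \<bar>m\<bar>)\<^sup>2"])
    show "AE y in \<gamma>. norm ((X y)\<^sup>2) \<le> (B + \<bar>m\<bar>)\<^sup>2"
      using power_mono[OF X_bdd abs_ge_zero, of _ 2] by (intro AE_I2) simp
  qed (use X in measurable)
  have mean: "expectation X = 0"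
    unfolding X_def using int_H by (simp add: m_eq prob_space)
  have le: "AE y in \<gamma>. X y \<le> b - m"
    using H_le by (simp add: X_def)
  have var: "s2 = expectation (\<lambda>y. (X y)\<^sup>2)"
    by (simp add: s2_eq m_eq X_def)
  have bound: "expectation (\<lambda>y. exp (c * X y))
      \<le> (b - m)\<^sup>2 / ((b - m)\<^sup>2 + s2) * exp (- c * s2 / (b - m))
        + s2 / ((b - m)\<^sup>2 + s2) * exp (c * (b - m))"
    using b_gt c_pos by (intro bennett_exp_moment_bound[OF X X2 mean le _ _ var]) auto
  \<comment> \<open>\<open>ln\<close> is monotone only on positive arguments; here \<open>exp x \<ge> 1 + x\<close> gives a moment of at least
      \<open>1\<close>.\<close>
  have "expectation (\<lambda>y. 1 + c * X y) \<le> expectation (\<lambda>y. exp (c * X y))"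
    using X c_pos le by (intro integral_mono integrable_exp_of_le) auto
  then have "0 < expectation (\<lambda>y. exp (c * X y))"
    using X by (simp add: mean prob_space)
  with bound have "ln (expectation (\<lambda>y. exp (c * X y)))
      \<le> ln ((b - m)\<^sup>2 / ((b - m)\<^sup>2 + s2) * exp (- c * s2 / (b - m))
        + s2 / ((b - m)\<^sup>2 + s2) * exp (c * (b - m)))"
    by (intro ln_mono) auto
  then have "1 / c * ln (expectation (\<lambda>y. exp (c * X y)))
      \<le> 1 / c * ln ((b - m)\<^sup>2 / ((b - m)\<^sup>2 + s2) * exp (- c * s2 / (b - m))
        + s2 / ((b - m)\<^sup>2 + s2) * exp (c * (b - m)))"
    using c_pos by (intro mult_left_mono) auto
  then show ?thesis
    by (simp only: risk_sensitive_performance_def X_def m_eq[symmetric])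
qed

end
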